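(* Let $M \geq 2$ be an integer. Then there are infinitely many pairwise non-nested arithmetic progressions $An+B$ (with $A, B$ positive integers) such that $$b_k(An+B) \equiv 0 \pmod{M}$$ for all even integers $k \geq 6$ and for all integers $n \geq 0$.
   Context: For an integer $j$ write $\sigma_j(n) := \sum_{d \mid n} d^j$, the sum over positive divisors of $n \ge 1$. For even $k \geq 6$ and integers $n \geq 1$ define $$b_6(n) := \frac{(n^2-n+1)\sigma_1(n) - \sigma_3(n)}{6}, \qquad b_k(n) := \frac{-n^2\sigma_{k-7}(n) + (n^2+1)\sigma_{k-5}(n) - \sigma_{k-3}(n)}{24} \quad (k \geq 8).$$ These numbers are integers for all $n\ge 1$. An arithmetic progression $An+B$ means the set $\{An+B : n \geq 0 \text{ an integer}\}$. A collection of progressions is non-nested if no progression in it is contained in a different progression in it. *)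

theory Defs
  imports "HOL-Number_Theory.Cong"
begin

definition sigma :: "nat \<Rightarrow> nat \<Rightarrow> nat" where
  "sigma j n = (\<Sum>d | d dvd n. d ^ j)"

(* Meaningful for even k >= 6 and n >= 1. There both integer divisions are exact (lemmas
   b_6_exact and b_ge_8_exact), and no truncated subtraction occurs in the indices of sigma. *)
definition b :: "nat \<Rightarrow> nat \<Rightarrow> int" where
  "b k n =
     (if k = 6 then
        (((int n)\<^sup>2 - int n + 1) * int (sigma 1 n) - int (sigma 3 n)) div 6
      else
        (- (int n)\<^sup>2 * int (sigma (k - 7) n) + ((int n)\<^sup>2 + 1) * int (sigma (k - 5) n)
           - int (sigma (k - 3) n)) div 24)"

definition progression :: "nat \<Rightarrow> nat \<Rightarrow> nat set" where
  "progression A B = {A * n + B | n. True}"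

definition non_nested :: "nat set set \<Rightarrow> bool" where
  "non_nested S \<longleftrightarrow> (\<forall>P\<in>S. \<forall>Q\<in>S. P \<noteq> Q \<longrightarrow> \<not> P \<subseteq> Q)"

lemma int_sigma: "int (sigma j n) = (\<Sum>d | d dvd n. int d ^ j)"
  by (simp add: sigma_def)

lemma six_dvd_cube_diff: "(6::int) dvd d * (d\<^sup>2 - 1)"
proof -
  have "d mod 6 \<in> {0,1,2,3,4,5}" by auto
  then have "(d * (d * d - 1)) mod 6 = 0"
    by (elim insertE emptyE; simp add: mod_simps mod_mult_eq[symmetric, of d]
        mod_diff_eq[symmetric, of "d * d"])
  then show ?thesis by (simp add: power2_eq_square mod_eq_0_iff_dvd)
qed

lemma sq_minus_one_odd: "odd (d::int) \<Longrightarrow> 8 dvd d\<^sup>2 - 1"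
proof -
  assume "odd d"
  then obtain c where c: "d = 2 * c + 1" by (elim oddE)
  have "even (c * (c + 1))" by simp
  then obtain e where "c * (c + 1) = 2 * e" by (elim evenE)
  then have "d\<^sup>2 - 1 = 8 * e" using c by (simp add: power2_eq_square algebra_simps)
  then show ?thesis by simp
qed

lemma term_24_dvd:
  fixes d n :: int
  assumes "d dvd n" "j \<ge> 1"
  shows "24 dvd d ^ j * ((d\<^sup>2 - 1) * (n\<^sup>2 - d\<^sup>2))"
proof -
  obtain i where j: "j = Suc i" using assms(2) by (cases j) auto
  have "24 dvd d * ((d\<^sup>2 - 1) * (n\<^sup>2 - d\<^sup>2))"
  proof -
    have "3 dvd d * (d\<^sup>2 - 1)"
      using six_dvd_cube_diff[of d] by (rule dvd_trans[rotated]) simp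
    then have three: "3 dvd d * ((d\<^sup>2 - 1) * (n\<^sup>2 - d\<^sup>2))"
      by (metis dvd_mult2 mult.assoc)
    have eight: "8 dvd d * ((d\<^sup>2 - 1) * (n\<^sup>2 - d\<^sup>2))"
    proof (cases "even d")
      case True
      then obtain c where c: "d = 2 * c" by (elim evenE)
      obtain e where e: "n = d * e" using assms(1) by (elim dvdE)
      have "d * ((d\<^sup>2 - 1) * (n\<^sup>2 - d\<^sup>2)) = 8 * (c ^ 3 * (d\<^sup>2 - 1) * (e\<^sup>2 - 1))"
        unfolding e c by (simp add: algebra_simps power2_eq_square power3_eq_cube)
      then show ?thesis by (metis dvd_triv_left)
    next
      case False
      then show ?thesis using sq_minus_one_odd[of d] by (intro dvd_mult dvd_mult2)
    qed
    have "3 dvd x \<Longrightarrow> 8 dvd x \<Longrightarrow> 24 dvd x" for x :: int by presburger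
    then show ?thesis using three eight by blast
  qed
  then have "24 dvd d ^ i * (d * ((d\<^sup>2 - 1) * (n\<^sup>2 - d\<^sup>2)))" by (rule dvd_mult)
  then show ?thesis unfolding j by (simp only: power_Suc mult.assoc mult.left_commute)
qed

lemma b_ge_8_exact:
  assumes "k \<ge> 8" "n \<ge> 1"
  shows "24 * b k n =
    - (int n)\<^sup>2 * int (sigma (k - 7) n) + ((int n)\<^sup>2 + 1) * int (sigma (k - 5) n)
      - int (sigma (k - 3) n)"
proof -
  obtain i where k: "k = i + 8" using assms(1) by (metis le_Suc_ex add.commute)
  have "- (int n)\<^sup>2 * int (sigma (k - 7) n) + ((int n)\<^sup>2 + 1) * int (sigma (k - 5) n)
      - int (sigma (k - 3) n)
    = (\<Sum>d | d dvd n. - (int n)\<^sup>2 * int d ^ (i + 1) + ((int n)\<^sup>2 + 1) * int d ^ (i + 3)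
        - int d ^ (i + 5))"
    unfolding k int_sigma by (simp add: sum.distrib sum_subtractf sum_distrib_left sum_negf add.commute)
  also have "\<dots> = (\<Sum>d | d dvd n. int d ^ (i + 1) * (((int d)\<^sup>2 - 1) * ((int n)\<^sup>2 - (int d)\<^sup>2)))"
    by (intro sum.cong refl) (simp add: algebra_simps power_add eval_nat_numeral)
  finally have eq: "- (int n)\<^sup>2 * int (sigma (k - 7) n) + ((int n)\<^sup>2 + 1) * int (sigma (k - 5) n)
      - int (sigma (k - 3) n)
    = (\<Sum>d | d dvd n. int d ^ (i + 1) * (((int d)\<^sup>2 - 1) * ((int n)\<^sup>2 - (int d)\<^sup>2)))" .
  have "24 dvd (\<Sum>d | d dvd n. int d ^ (i + 1) * (((int d)\<^sup>2 - 1) * ((int n)\<^sup>2 - (int d)\<^sup>2)))"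
    by (intro dvd_sum term_24_dvd) auto
  then show ?thesis using assms(1) unfolding b_def eq by simp
qed

lemma three_dvd_sigma_one:
  assumes "n mod 3 = 2"
  shows "3 dvd sigma 1 n"
proof -
  have n: "n > 0" using assms by (cases n) auto
  define D where "D r = {d. d dvd n \<and> d mod 3 = r}" for r :: nat
  have fin: "finite (D r)" for r unfolding D_def using n by simp
  have swap: "(n div d) mod 3 = (if d mod 3 = 1 then 2 else 1) \<and> (d mod 3 = 1 \<or> d mod 3 = 2)"
    if "d dvd n" for d
  proof -
    have "(d mod 3) * ((n div d) mod 3) mod 3 = 2"
      using that assms by (simp add: mod_mult_eq)
    moreover have "d mod 3 \<in> {0,1,2}" "(n div d) mod 3 \<in> {0,1,2}" by auto
    ultimately show ?thesis by (elim insertE emptyE; simp)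
  qed
  have "{d. d dvd n} = D 1 \<union> D 2" unfolding D_def using swap by auto
  then have "sigma 1 n = (\<Sum>d\<in>D 1 \<union> D 2. d)" by (simp add: sigma_def)
  also have "\<dots> = (\<Sum>d\<in>D 1. d) + (\<Sum>d\<in>D 2. d)"
    using fin by (intro sum.union_disjoint) (auto simp: D_def)
  also have "(\<Sum>d\<in>D 2. d) = (\<Sum>d\<in>D 1. n div d)"
    by (rule sum.reindex_bij_witness[of _ "\<lambda>d. n div d" "\<lambda>d. n div d"])
      (use swap n in \<open>auto simp: D_def\<close>)
  also have "(\<Sum>d\<in>D 1. d) + (\<Sum>d\<in>D 1. n div d) = (\<Sum>d\<in>D 1. d + n div d)"
    by (simp add: sum.distrib)
  finally have eq: "sigma 1 n = (\<Sum>d\<in>D 1. d + n div d)" .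
  show ?thesis unfolding eq
  proof (rule dvd_sum)
    fix d assume "d \<in> D 1"
    then have "d mod 3 = 1" "(n div d) mod 3 = 2" using swap[of d] by (auto simp: D_def)
    moreover have "x mod 3 = 1 \<Longrightarrow> y mod 3 = 2 \<Longrightarrow> 3 dvd x + y" for x y :: nat by presburger
    ultimately show "3 dvd d + n div d" by blast
  qed
qed

lemma b_6_exact:
  assumes "n \<ge> 1"
  shows "6 * b 6 n = ((int n)\<^sup>2 - int n + 1) * int (sigma 1 n) - int (sigma 3 n)"
proof -
  have "6 dvd (\<Sum>d | d dvd n. int d * ((int d)\<^sup>2 - 1))"
    by (intro dvd_sum six_dvd_cube_diff)
  also have "(\<Sum>d | d dvd n. int d * ((int d)\<^sup>2 - 1)) = int (sigma 3 n) - int (sigma 1 n)"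
    unfolding int_sigma
    by (simp add: sum_subtractf[symmetric] algebra_simps power2_eq_square power3_eq_cube)
  finally have d1: "6 dvd int (sigma 3 n) - int (sigma 1 n)" .
  have two: "2 dvd int n * (int n - 1) * int (sigma 1 n)" by simp
  have three: "3 dvd int n * (int n - 1) * int (sigma 1 n)"
  proof (cases "n mod 3 = 2")
    case True
    then have "3 dvd int (sigma 1 n)"
      using three_dvd_sigma_one[of n] by presburger
    then show ?thesis by simp
  next
    case False
    then have "3 dvd int n \<or> 3 dvd int n - 1" by presburger
    then show ?thesis by auto
  qed
  have "2 dvd x \<Longrightarrow> 3 dvd x \<Longrightarrow> 6 dvd x" for x :: int by presburger
  then have "6 dvd int n * (int n - 1) * int (sigma 1 n)" using two three by blast
  then have "6 dvd int n * (int n - 1) * int (sigma 1 n) - (int (sigma 3 n) - int (sigma 1 n))"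
    using d1 by (rule dvd_diff)
  also have "\<dots> = ((int n)\<^sup>2 - int n + 1) * int (sigma 1 n) - int (sigma 3 n)"
    by (simp add: algebra_simps power2_eq_square)
  finally show ?thesis unfolding b_def by simp
qed

end

theory Submission
  imports Defs "HOL-Number_Theory.Residues"
begin

text \<open>
  Put \<open>N = 24 M\<close> and let \<open>p\<close> be a prime not dividing \<open>N\<close>. By Euler's theorem the residues
  \<open>p ^ (i j)\<close> are periodic in \<open>i\<close> with period \<open>\<phi>(N)\<close>, so \<open>\<sigma>\<^sub>j\<close> of \<open>p ^ (N \<phi>(N) - 1)\<close> is a sum of
  \<open>N\<close> congruent blocks and vanishes modulo \<open>N\<close>, for every \<open>j\<close> at once. By multiplicativity all
  the \<open>\<sigma>\<^sub>j\<close>, hence all the \<open>b\<^sub>k\<close>, vanish on the integers exactly divisible by that power of \<open>p\<close>.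
  The progressions for different \<open>p\<close> have coprime moduli, so none contains another.
\<close>

text \<open>Multiplying a divisor of \<open>m\<close> by a divisor of \<open>n\<close> is a
  bijection onto the divisors of \<open>m * n\<close>; its inverse takes the gcd with
  \<open>m\<close> and with \<open>n\<close>.\<close>

lemma sigma_mult_coprime:
  assumes "coprime m n"
  shows "sigma j (m * n) = sigma j m * sigma j n"
proof -
  have gcds: "gcd (x * y) m = x \<and> gcd (x * y) n = y" if "x dvd m" "y dvd n" for x y
  proof -
    have "coprime x n" "coprime y m"
      using that assms by (auto intro: coprime_divisors[OF _ dvd_refl] simp: coprime_commute)
    with that show ?thesis
      by (simp add: gcd_mult_left_right_cancel gcd_mult_left_left_cancel gcd_proj1_iff
          coprime_commute)
  qed
  have "sigma j m * sigma j n = (\<Sum>(x, y)\<in>{d. d dvd m} \<times> {d. d dvd n}. (x * y) ^ j)"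
    by (simp add: sigma_def sum_product sum.cartesian_product power_mult_distrib)
  also have "\<dots> = (\<Sum>d | d dvd m * n. d ^ j)"
  proof (rule sum.reindex_bij_witness[of _ "\<lambda>d. (gcd d m, gcd d n)" "\<lambda>(x, y). x * y"], goal_cases)
    \<comment> \<open>This case is \<open>gcd d m * gcd d n = d\<close>; splitting \<open>d\<close>
      into divisors of \<open>m\<close> and \<open>n\<close> reduces it to
      \<open>gcds\<close>.\<close>
    case (3 d)
    then obtain x y where "d = x * y" "x dvd m" "y dvd n"
      using division_decomp by blast
    then show ?case by (simp add: gcds)
  qed (auto simp: gcds mult_dvd_mono)
  finally show ?thesis by (simp add: sigma_def)
qed

lemma sigma_prime_power:
  assumes "prime p"
  shows "sigma j (p ^ a) = (\<Sum>i\<le>a. (p ^ j) ^ i)"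
proof -
  have "{d. d dvd p ^ a} = (\<lambda>i. p ^ i) ` {..a}"
    using assms by (auto simp: divides_primepow_nat)
  moreover have "inj_on (\<lambda>i. p ^ i) {..a}"
    using prime_gt_1_nat[OF assms] by (auto intro!: inj_onI)
  ultimately show ?thesis
    by (simp add: sigma_def sum.reindex power_mult[symmetric] mult.commute)
qed

text \<open>Blocks replace the closed form of the geometric sum, because \<open>r - 1\<close> may
  share factors with \<open>N\<close>.\<close>

lemma dvd_sum_powers_totient:
  fixes N r :: nat
  assumes "coprime r N"
  shows "N dvd (\<Sum>i<N * totient N. r ^ i)"
proof -
  let ?t = "totient N"
  have block: "[(\<Sum>i=m * ?t..<m * ?t + ?t. r ^ i) = (\<Sum>i<?t. r ^ i)] (mod N)" for m
  proof -
    have "[(r ^ ?t) ^ m * (\<Sum>i<?t. r ^ i) = 1 ^ m * (\<Sum>i<?t. r ^ i)] (mod N)"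
      using euler_theorem[OF assms] by (intro cong_mult cong_pow cong_refl)
    moreover have "(\<Sum>i=m * ?t..<m * ?t + ?t. r ^ i) = (r ^ ?t) ^ m * (\<Sum>i<?t. r ^ i)"
      using sum.shift_bounds_nat_ivl[of "\<lambda>i. r ^ i" 0 "m * ?t" ?t]
      by (simp add: power_add power_mult[symmetric] sum_distrib_right atLeast0LessThan ac_simps)
    ultimately show ?thesis by simp
  qed
  have "(\<Sum>i<N * ?t. r ^ i) = (\<Sum>m<N. \<Sum>i=m * ?t..<m * ?t + ?t. r ^ i)"
    by (rule sum.nat_group[symmetric])
  also have "[\<dots> = (\<Sum>m<N. \<Sum>i<?t. r ^ i)] (mod N)"
    by (intro cong_sum block)
  also have "[(\<Sum>m<N. \<Sum>i<?t. r ^ i) = 0] (mod N)"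
    by (simp add: cong_0_iff)
  finally show ?thesis by (simp add: cong_0_iff)
qed

lemma dvd_sigma_prime_power_mult:
  assumes "prime p" "coprime p N" "N > 0" "coprime p m"
  shows "N dvd sigma j (p ^ (N * totient N - 1) * m)"
proof -
  \<comment> \<open>Positivity keeps the subtraction in the exponent from truncating, so the sum has
    exactly \<open>N * totient N\<close> terms.\<close>
  have "N * totient N > 0" using assms by simp
  then have "{..N * totient N - 1} = {..<N * totient N}"
    by (metis Suc_diff_1 lessThan_Suc_atMost)
  then have "N dvd sigma j (p ^ (N * totient N - 1))"
    using dvd_sum_powers_totient[of "p ^ j" N] assms by (simp add: sigma_prime_power)
  then show ?thesis
    using assms by (simp add: sigma_mult_coprime)
qed

text \<open>The factor 24 absorbs the denominators 24 and 6. As \<open>j\<close> is arbitrary, one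
  hypothesis serves all \<open>k\<close>.\<close>

lemma dvd_b_of_dvd_sigma:
  assumes "\<And>j. 24 * M dvd int (sigma j n)"
  shows "M dvd b k n"
proof -
  have div: "M dvd x div c" if "c * M dvd x" "c \<noteq> 0" for x c :: int
    using that by (auto simp: dvd_def)
  have "6 * M dvd int (sigma j n)" for j
    using assms[of j] by (rule dvd_trans[rotated]) (intro mult_dvd_mono; simp)
  then show ?thesis
    using assms unfolding b_def by (auto intro!: div dvd_add dvd_diff dvd_mult)
qed

text \<open>Two consecutive members of the smaller progression differ by \<open>A\<close>, and any
  two members of the larger one by a multiple of \<open>C\<close>.\<close>

lemma dvd_of_progression_subset:
  assumes "progression A B \<subseteq> progression C D"
  shows "C dvd A"
proof -
  have "B \<in> progression A B" "A + B \<in> progression A B"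
    by (auto simp: progression_def intro: exI[of _ 0] exI[of _ 1])
  then have "B \<in> progression C D" "A + B \<in> progression C D"
    using assms by blast+
  then obtain x y where "B = C * x + D" "A + B = C * y + D"
    by (auto simp only: progression_def mem_Collect_eq)
  then have "int A = int C * (int y - int x)"
    by (simp add: algebra_simps flip: of_nat_mult of_nat_add)
  then show ?thesis by (metis dvd_triv_left int_dvd_int_iff)
qed

theorem theorem1p1:
  fixes M :: int
  assumes "M \<ge> 2"
  shows "\<exists>S :: nat set set. infinite S \<and> non_nested S \<and>
    (\<forall>P\<in>S. \<exists>A B. A > 0 \<and> B > 0 \<and> P = progression A B \<and>
      (\<forall>k n. even k \<and> k \<ge> 6 \<longrightarrow> [b k (A * n + B) = 0] (mod M)))"
proof -
  define N where "N = nat (24 * M)"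
  define E where "E = N * totient N"
  \<comment> \<open>A prime above \<open>N\<close> cannot divide \<open>N\<close>, hence is coprime
    to it.\<close>
  define Q where "Q = {p :: nat. prime p \<and> p > N}"
  \<comment> \<open>The members are \<open>p ^ (E - 1) * (p * n + 1)\<close>, whose second factor is
    coprime to \<open>p\<close>.\<close>
  define F where "F p = progression (p ^ E) (p ^ (E - 1))" for p :: nat
  have N: "N > 0" "int N = 24 * M" using assms by (auto simp: N_def)
  then have E: "E > 0" by (simp add: E_def)
  \<comment> \<open>This yields both the injectivity of \<open>F\<close>, hence infinitely many
    progressions, and non-nestedness.\<close>
  have F_subset: "p = q" if "p \<in> Q" "q \<in> Q" "F p \<subseteq> F q" for p q
  proof -
    have "q ^ E dvd p ^ E"
      using that(3) unfolding F_def by (rule dvd_of_progression_subset)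
    then have "q dvd p" using E by simp
    then show ?thesis using that primes_dvd_imp_eq[of q p] by (simp add: Q_def)
  qed
  have "infinite Q"
    unfolding infinite_nat_iff_unbounded Q_def
    by (metis (mono_tags, lifting) bigger_prime max_less_iff_conj mem_Collect_eq)
  moreover have "inj_on F Q"
    using F_subset by (intro inj_onI) simp
  ultimately have "infinite (F ` Q)"
    by (simp add: finite_image_iff)
  moreover have "non_nested (F ` Q)"
    unfolding non_nested_def using F_subset by blast
  moreover have "M dvd b k (p ^ E * n + p ^ (E - 1))" if "p \<in> Q" for p k n
  proof (rule dvd_b_of_dvd_sigma)
    fix j
    have p: "prime p" "p > N" using that by (auto simp: Q_def)
    then have "coprime p N"
      using N by (intro prime_imp_coprime) (auto dest: dvd_imp_le)
    moreover have "coprime p (p * n + 1)"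
      by (metis coprime_1_right coprime_iff_gcd_eq_1 gcd_add_mult mult.commute add.commute)
    ultimately have "N dvd sigma j (p ^ (E - 1) * (p * n + 1))"
      unfolding E_def using p N by (intro dvd_sigma_prime_power_mult)
    also have "p ^ (E - 1) * (p * n + 1) = p ^ E * n + p ^ (E - 1)"
      using E by (cases E) (simp_all add: algebra_simps)
    finally show "24 * M dvd int (sigma j (p ^ E * n + p ^ (E - 1)))"
      using N by (metis int_dvd_int_iff)
  qed
  moreover have "p ^ i > 0" if "p \<in> Q" for p i
    using that by (simp add: Q_def prime_gt_0_nat)
  ultimately have "infinite (F ` Q) \<and> non_nested (F ` Q) \<and>
    (\<forall>P\<in>F ` Q. \<exists>A B. A > 0 \<and> B > 0 \<and> P = progression A B \<and>
      (\<forall>k n. even k \<and> k \<ge> 6 \<longrightarrow> [b k (A * n + B) = 0] (mod M)))"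
    unfolding F_def cong_0_iff by blast
  then show ?thesis ..
qed

end
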